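(* Let $v=[C,\overline w^\top,\zeta^\top,z^\top,\alpha^\top,\xi^\top,\beta^\top,\gamma^\top]^\top$ be a feasible point of the problem (P) defined in the context, and for $t=1,\dots,K$ put $w^t:=(B^t)^\top\alpha^t+\beta^t-\gamma^t\in\mathbb{R}^n$. Assume that $-\overline w<w^t<\overline w$ (componentwise) for all $t=1,\dots,K$, and that the matrix $$\overline B:=(BB^\top)_{(\Lambda_1\cup\Lambda_3,\ \Lambda_1\cup\Lambda_3)}$$ is positive definite, where $$\Lambda_1=\{i\in[Km_2] : \alpha_i=0,\ (BB^\top\alpha+B\beta-B\gamma-\mathbf 1+\xi)_i=0,\ \xi_i=0\},$$ $$\Lambda_3=\{i\in[Km_2] : 0<\alpha_i\le C,\ (BB^\top\alpha+B\beta-B\gamma-\mathbf 1+\xi)_i=0,\ \xi_i=0\}.$$ Then $v$ automatically satisfies the MPEC-MFCQ for (P).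
   Context: **Problem (P).** Let $K,m_1,m_2,n$ be positive integers, $[N]:=\{1,\dots,N\}$, and let $\mathbf 1$ denote an all-ones vector. In $K$-fold cross-validation a data set of labelled points $(x,y)$, $x\in\mathbb{R}^n$, $y\in\{\pm1\}$, is partitioned into $K$ disjoint validation sets of size $m_1$; the training set of fold $t$ is the complement of the $t$-th validation set and has size $m_2$. (Each $x$ already includes an additional component equal to 1 that absorbs the bias term.) Let $B^t\in\mathbb{R}^{m_2\times n}$ be the matrix whose rows are $y\,x^\top$ over the training points of fold $t$, and $A^t\in\mathbb{R}^{m_1\times n}$ the matrix whose rows are $y\,x^\top$ over the validation points of fold $t$. Let $B=\mathrm{diag}(B^1,\dots,B^K)\in\mathbb{R}^{Km_2\times Kn}$ and $A=\mathrm{diag}(A^1,\dots,A^K)\in\mathbb{R}^{Km_1\times Kn}$ (block diagonal), and let $E_K^n\in\mathbb{R}^{Kn\times n}$ be $K$ copies of $I_n$ stacked vertically. Let $C_{lb},C_{ub}\in\mathbb{R}_+$ and $\overline w_{lb},\overline w_{ub}\in\mathbb{R}^n_+$ be given bounds. Put $\overline n=1+n$, $\overline m=2K(m_1+m_2+n)$. The variable is $v=[C,\overline w^\top,\zeta^\top,z^\top,\alpha^\top,\xi^\top,\beta^\top,\gamma^\top]^\top\in\mathbb{R}^{\overline n+\overline m}$ with $C\in\mathbb{R}$, $\overline w\in\mathbb{R}^n$, $\zeta,z\in\mathbb{R}^{Km_1}$, $\alpha,\xi\in\mathbb{R}^{Km_2}$, $\beta,\gamma\in\mathbb{R}^{Kn}$;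 each of $\zeta,z,\alpha,\xi,\beta,\gamma$ is the stack of $K$ blocks $\zeta^t$, $\alpha^t$, etc. Problem (P) is $$\min_v f(v)\quad\text{s.t.}\quad g(v)\ge\mathbf 0,\quad \mathbf 0\le H(v)\perp G(v)\ge\mathbf 0,$$ with $f(v)=\frac1{Km_1}\mathbf 1^\top\zeta$, $g(v)=(C_{ub}-C,\ C-C_{lb},\ \overline w_{ub}-\overline w,\ \overline w-\overline w_{lb})\in\mathbb{R}^{2\overline n}$, $H(v)=(\zeta,z,\alpha,\xi,\beta,\gamma)\in\mathbb{R}^{\overline m}$, and $$G(v)=\begin{pmatrix}AB^\top\alpha+A\beta-A\gamma+z\\ \mathbf 1-\zeta\\ BB^\top\alpha+B\beta-B\gamma-\mathbf 1+\xi\\ \mathbf 1C-\alpha\\ B^\top\alpha+\beta-\gamma+E_K^n\overline w\\ -B^\top\alpha-\beta+\gamma+E_K^n\overline w\end{pmatrix}\in\mathbb{R}^{\overline m}.$$ **Standing assumptions.** (i) No validation point lies on the decision boundary: for each $t$ and each validation point $x$ of fold $t$, $x^\top w^t\ne0$, where $w^t=(B^t)^\top\alpha^t+\beta^t-\gamma^t$; equivalently, every component of $A(B^\top\alpha+\beta-\gamma)$ is nonzero. (ii) For each fold $t$ there is at least one training point with label $1$ that is not a support vector and at least one with label $-1$ that is not a support vector. (iii) For each fold $t$ there are at least two training points with label $1$ that are support vectors and at least two with label $-1$ that are support vectors. (A support vector of fold $t$ is a training point whose multiplier, the corresponding component of $\alpha^t$, is positive.) **Notation.** $M_{(I,J)}$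 is the submatrix of $M$ with rows indexed by $I$ and columns indexed by $J$. **MPEC-MFCQ.** Families of vectors $V_a=\{\tilde a_i\}_{i\in I_1}$, $V_b=\{\tilde b_i\}_{i\in I_2}$ are positive-linearly dependent if there are scalars $\tau_i\ge0$ ($i\in I_1$) and $\sigma_i\in\mathbb{R}$ ($i\in I_2$), not all zero, with $\sum_{i\in I_1}\tau_i\tilde a_i+\sum_{i\in I_2}\sigma_i\tilde b_i=\mathbf 0$; otherwise $(V_a,V_b)$ is positive-linearly independent. For $v$ feasible for (P) let $I_G=\{i\in[\overline m]:G_i(v)=0,H_i(v)>0\}$, $I_{GH}=\{i\in[\overline m]:G_i(v)=0,H_i(v)=0\}$, $I_H=\{i\in[\overline m]:G_i(v)>0,H_i(v)=0\}$, $I_g=\{i\in[2\overline n]:g_i(v)=0\}$. Then $v$ satisfies the MPEC-MFCQ if and only if $(V_a,V_b)$ is positive-linearly independent, where $V_a=\{\nabla g_i(v)\}_{i\in I_g}\cup\{\nabla G_i(v)\}_{i\in I_{GH}}\cup\{\nabla H_i(v)\}_{i\in I_{GH}}$ and $V_b=\{\nabla G_i(v)\}_{i\in I_G}\cup\{\nabla H_i(v)\}_{i\in I_H}$ (indexed families).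
   Formalization: The bounds are assumed strict: C_lb < C_ub, and w̄_lb < w̄_ub in every component. If a lower and an upper bound coincide, both constraints are active with opposite gradients, so MPEC-MFCQ fails at every feasible point and the claim is false there. *)

theory Defs
  imports "HOL-Analysis.Analysis"
begin

section \<open>Mathematical programs with equilibrium constraints\<close>

text \<open>
  The program: minimise the objective subject to \<open>0 \<le> g\<close> and \<open>0 \<le> H \<bottom> G \<ge> 0\<close>.
\<close>

record ('v, 'i, 'j) mpec =
  objective :: "'v \<Rightarrow> real"
  g_map :: "'v \<Rightarrow> real ^ 'i"
  G_map :: "'v \<Rightarrow> real ^ 'j"
  H_map :: "'v \<Rightarrow> real ^ 'j"

text \<open>On vectors, the order \<open>\<le>\<close> of the library is the componentwise one.\<close>

definition feasible :: "('v, 'i::finite, 'j::finite) mpec \<Rightarrow> 'v \<Rightarrow> bool" where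
  "feasible P v \<longleftrightarrow>
     0 \<le> g_map P v \<and> 0 \<le> H_map P v \<and> 0 \<le> G_map P v \<and> H_map P v \<bullet> G_map P v = 0"

definition gradient :: "('v::euclidean_space \<Rightarrow> real) \<Rightarrow> 'v \<Rightarrow> 'v" where
  "gradient f x = (THE D. GDERIV f x :> D)"

definition pos_lin_dependent ::
  "'a set \<Rightarrow> ('a \<Rightarrow> 'v::real_vector) \<Rightarrow> 'b set \<Rightarrow> ('b \<Rightarrow> 'v) \<Rightarrow> bool" where
  "pos_lin_dependent I1 a I2 b \<longleftrightarrow>
     (\<exists>(\<tau> :: 'a \<Rightarrow> real) (\<sigma> :: 'b \<Rightarrow> real).
        (\<forall>i\<in>I1. \<tau> i \<ge> 0) \<and>
        ((\<exists>i\<in>I1. \<tau> i \<noteq> 0) \<or> (\<exists>i\<in>I2. \<sigma> i \<noteq> 0)) \<and>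
        (\<Sum>i\<in>I1. \<tau> i *\<^sub>R a i) + (\<Sum>i\<in>I2. \<sigma> i *\<^sub>R b i) = 0)"

definition I_G :: "('v, 'i::finite, 'j::finite) mpec \<Rightarrow> 'v \<Rightarrow> 'j set" where
  "I_G P v = {i. G_map P v $ i = 0 \<and> H_map P v $ i > 0}"

definition I_GH :: "('v, 'i::finite, 'j::finite) mpec \<Rightarrow> 'v \<Rightarrow> 'j set" where
  "I_GH P v = {i. G_map P v $ i = 0 \<and> H_map P v $ i = 0}"

definition I_H :: "('v, 'i::finite, 'j::finite) mpec \<Rightarrow> 'v \<Rightarrow> 'j set" where
  "I_H P v = {i. G_map P v $ i > 0 \<and> H_map P v $ i = 0}"

definition I_g :: "('v, 'i::finite, 'j::finite) mpec \<Rightarrow> 'v \<Rightarrow> 'i set" where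
  "I_g P v = {i. g_map P v $ i = 0}"

abbreviation grad_g :: "('v::euclidean_space, 'i::finite, 'j::finite) mpec \<Rightarrow> 'v \<Rightarrow> 'i \<Rightarrow> 'v" where
  "grad_g P v i \<equiv> gradient (\<lambda>u. g_map P u $ i) v"

abbreviation grad_G :: "('v::euclidean_space, 'i::finite, 'j::finite) mpec \<Rightarrow> 'v \<Rightarrow> 'j \<Rightarrow> 'v" where
  "grad_G P v i \<equiv> gradient (\<lambda>u. G_map P u $ i) v"

abbreviation grad_H :: "('v::euclidean_space, 'i::finite, 'j::finite) mpec \<Rightarrow> 'v \<Rightarrow> 'j \<Rightarrow> 'v" where
  "grad_H P v i \<equiv> gradient (\<lambda>u. H_map P u $ i) v"

text \<open>
  The unions of families of gradients are unions of indexed families, so they are indexed by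
  disjoint sums of the index sets; equal gradients with different indices count separately.
\<close>

definition mpec_mfcq ::
  "('v::euclidean_space, 'i::finite, 'j::finite) mpec \<Rightarrow> 'v \<Rightarrow> bool" where
  "mpec_mfcq P v \<longleftrightarrow>
     \<not> pos_lin_dependent
         (I_g P v <+> (I_GH P v <+> I_GH P v))
         (case_sum (grad_g P v) (case_sum (grad_G P v) (grad_H P v)))
         (I_G P v <+> I_H P v)
         (case_sum (grad_G P v) (grad_H P v))"


section \<open>Submatrices and positive definiteness\<close>

text \<open>
  A submatrix indexed by arbitrary sets \<open>I\<close> and \<open>J\<close> of rows and columns is a function, of
  which only the entries in \<open>I \<times> J\<close> matter.
\<close>

definition submat :: "real ^ 'b ^ 'a \<Rightarrow> 'a set \<Rightarrow> 'b set \<Rightarrow> 'a::finite \<Rightarrow> 'b::finite \<Rightarrow> real" where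
  "submat M I J = (\<lambda>i\<in>I. \<lambda>j\<in>J. M $ i $ j)"

definition positive_definite_on :: "'a set \<Rightarrow> ('a \<Rightarrow> 'a \<Rightarrow> real) \<Rightarrow> bool" where
  "positive_definite_on I N \<longleftrightarrow>
     (\<forall>i\<in>I. \<forall>j\<in>I. N i j = N j i) \<and>
     (\<forall>x :: 'a \<Rightarrow> real. (\<exists>i\<in>I. x i \<noteq> 0) \<longrightarrow> (\<Sum>i\<in>I. \<Sum>j\<in>I. x i * N i j * x j) > 0)"


section \<open>Stacked vectors and block matrices\<close>

definition stack :: "real ^ 'a \<Rightarrow> real ^ 'b \<Rightarrow> real ^ ('a::finite + 'b::finite)"  (infixr "@@" 65)
  where "u @@ v = (\<chi> i. case i of Inl a \<Rightarrow> u $ a | Inr b \<Rightarrow> v $ b)"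

text \<open>
  Vectors stacked from blocks \<open>t = 1, \<dots>, K\<close> are indexed by pairs of a block and a position
  inside the block, where \<open>K\<close> is the cardinality of the type \<open>'k\<close>.
\<close>

definition block :: "real ^ ('k \<times> 'a) \<Rightarrow> 'k::finite \<Rightarrow> real ^ 'a::finite" where
  "block u t = (\<chi> i. u $ (t, i))"

definition block_diag ::
  "('k \<Rightarrow> real ^ 'b ^ 'a) \<Rightarrow> real ^ ('k::finite \<times> 'b::finite) ^ ('k \<times> 'a::finite)" where
  "block_diag M = (\<chi> r c. if fst r = fst c then M (fst r) $ snd r $ snd c else 0)"

definition stacked_id :: "real ^ 'n ^ ('k::finite \<times> 'n::finite)" where
  "stacked_id = (\<chi> r c. if snd r = c then 1 else 0)"


section \<open>The bilevel cross-validation problem\<close>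

text \<open>
  The data points are indexed by \<open>'d\<close>, the folds by \<open>'k\<close>, the positions in a validation set by
  \<open>'p\<close>, those in a training set by \<open>'q\<close> and the features by \<open>'n\<close>; the cardinalities
  of the last four types are \<open>K\<close>, \<open>m\<^sub>1\<close>, \<open>m\<^sub>2\<close> and \<open>n\<close>.  The maps \<open>val_pt D t\<close> and
  \<open>trn_pt D t\<close> enumerate the validation and the training points of fold \<open>t\<close> and thereby fix the
  order of the rows of the data matrices.
\<close>

record ('d, 'k, 'p, 'q, 'n) cv_data =
  feature :: "'d \<Rightarrow> real ^ 'n"
  label :: "'d \<Rightarrow> real"
  val_set :: "'k \<Rightarrow> 'd set"
  val_pt :: "'k \<Rightarrow> 'p \<Rightarrow> 'd"
  trn_pt :: "'k \<Rightarrow> 'q \<Rightarrow> 'd"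
  C_lb :: real
  C_ub :: real
  wbar_lb :: "real ^ 'n"
  wbar_ub :: "real ^ 'n"

definition cv_data_wf :: "('d, 'k, 'p, 'q, 'n::finite) cv_data \<Rightarrow> bool" where
  "cv_data_wf D \<longleftrightarrow>
     (\<forall>d. label D d \<in> {-1, 1}) \<and>
     (\<exists>j. \<forall>d. feature D d $ j = 1) \<and>
     disjoint_family (val_set D) \<and> (\<Union>t. val_set D t) = UNIV \<and>
     (\<forall>t. bij_betw (val_pt D t) UNIV (val_set D t)) \<and>
     (\<forall>t. bij_betw (trn_pt D t) UNIV (- val_set D t)) \<and>
     0 \<le> C_lb D \<and> 0 \<le> C_ub D \<and> 0 \<le> wbar_lb D \<and> 0 \<le> wbar_ub D"

definition val_mat :: "('d, 'k, 'p, 'q, 'n) cv_data \<Rightarrow> 'k \<Rightarrow> real ^ 'n::finite ^ 'p::finite" where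
  "val_mat D t = (\<chi> i. label D (val_pt D t i) *\<^sub>R feature D (val_pt D t i))"

definition trn_mat :: "('d, 'k, 'p, 'q, 'n) cv_data \<Rightarrow> 'k \<Rightarrow> real ^ 'n::finite ^ 'q::finite" where
  "trn_mat D t = (\<chi> i. label D (trn_pt D t i) *\<^sub>R feature D (trn_pt D t i))"

definition A_mat ::
  "('d, 'k, 'p, 'q, 'n) cv_data \<Rightarrow> real ^ ('k::finite \<times> 'n::finite) ^ ('k \<times> 'p::finite)" where
  "A_mat D = block_diag (val_mat D)"

definition B_mat ::
  "('d, 'k, 'p, 'q, 'n) cv_data \<Rightarrow> real ^ ('k::finite \<times> 'n::finite) ^ ('k \<times> 'q::finite)" where
  "B_mat D = block_diag (trn_mat D)"

text \<open>
  The variable \<open>(C, w, \<zeta>, z, \<alpha>, \<xi>, \<beta>, \<gamma>)\<close>.  Products carry the Euclidean inner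
  product, so this is a Euclidean space of dimension \<open>1 + n + 2K(m\<^sub>1 + m\<^sub>2 + n)\<close>.
\<close>

type_synonym ('k, 'p, 'q, 'n) var =
  "real \<times> (real ^ 'n) \<times> (real ^ ('k \<times> 'p)) \<times> (real ^ ('k \<times> 'p)) \<times>
   (real ^ ('k \<times> 'q)) \<times> (real ^ ('k \<times> 'q)) \<times> (real ^ ('k \<times> 'n)) \<times> (real ^ ('k \<times> 'n))"

type_synonym ('k, 'p, 'q, 'n) comp_index =
  "('k \<times> 'p) + ('k \<times> 'p) + ('k \<times> 'q) + ('k \<times> 'q) + ('k \<times> 'n) + ('k \<times> 'n)"

type_synonym 'n ineq_index = "1 + 1 + 'n + 'n"

definition problem_P ::
  "('d, 'k::finite, 'p::finite, 'q::finite, 'n::finite) cv_data \<Rightarrow>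
   (('k, 'p, 'q, 'n) var, 'n ineq_index, ('k, 'p, 'q, 'n) comp_index) mpec" where
  "problem_P D = \<lparr>
     objective = (\<lambda>(C, w, \<zeta>, z, \<alpha>, \<xi>, \<beta>, \<gamma>).
       1 / real (CARD('k) * CARD('p)) * (1 \<bullet> \<zeta>)),
     g_map = (\<lambda>(C, w, \<zeta>, z, \<alpha>, \<xi>, \<beta>, \<gamma>).
       vec (C_ub D - C) @@ vec (C - C_lb D) @@ (wbar_ub D - w) @@ (w - wbar_lb D)),
     G_map = (\<lambda>(C, w, \<zeta>, z, \<alpha>, \<xi>, \<beta>, \<gamma>).
       ((A_mat D ** transpose (B_mat D)) *v \<alpha> + A_mat D *v \<beta> - A_mat D *v \<gamma> + z) @@
       (1 - \<zeta>) @@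
       ((B_mat D ** transpose (B_mat D)) *v \<alpha> + B_mat D *v \<beta> - B_mat D *v \<gamma> - 1 + \<xi>) @@
       (vec C - \<alpha>) @@
       (transpose (B_mat D) *v \<alpha> + \<beta> - \<gamma> + stacked_id *v w) @@
       (- (transpose (B_mat D) *v \<alpha>) - \<beta> + \<gamma> + stacked_id *v w)),
     H_map = (\<lambda>(C, w, \<zeta>, z, \<alpha>, \<xi>, \<beta>, \<gamma>). \<zeta> @@ z @@ \<alpha> @@ \<xi> @@ \<beta> @@ \<gamma>)
   \<rparr>"

definition w_fold ::
  "('d, 'k, 'p, 'q, 'n) cv_data \<Rightarrow> real ^ ('k \<times> 'q::finite) \<Rightarrow> real ^ ('k \<times> 'n) \<Rightarrow> real ^ ('k \<times> 'n) \<Rightarrow>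
   'k::finite \<Rightarrow> real ^ 'n::finite" where
  "w_fold D \<alpha> \<beta> \<gamma> t = transpose (trn_mat D t) *v block \<alpha> t + block \<beta> t - block \<gamma> t"

definition support_vectors ::
  "real ^ ('k \<times> 'q) \<Rightarrow> 'k::finite \<Rightarrow> 'q::finite set" where
  "support_vectors \<alpha> t = {i. \<alpha> $ (t, i) > 0}"

definition trn_class ::
  "('d, 'k, 'p, 'q, 'n::finite) cv_data \<Rightarrow> 'k \<Rightarrow> real \<Rightarrow> 'q set" where
  "trn_class D t y = {i. label D (trn_pt D t i) = y}"

end

theory Submission
  imports Defs
begin

text \<open>
  The multipliers of a positive-linear dependence are shown to vanish block by block.  Write
  \<open>a, b, c, d, e, f\<close> for the multipliers of the six blocks of \<open>G\<close> and \<open>p, q, r, s, k, l\<close> for those of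
  the six blocks of \<open>H\<close>.  All constraints are affine, so the dependence says that a linear
  form in the direction \<open>h = (hC, hw, h\<zeta>, hz, h\<alpha>, h\<xi>, h\<beta>, h\<gamma>)\<close> is identically zero, and special
  directions give the equations between the multipliers.

  Since every \<open>w\<^sup>t\<close> lies strictly inside the box, the last two blocks of \<open>G\<close> are inactive, so
  \<open>e = f = 0\<close>.  The directions \<open>h\<zeta>, hz, h\<xi>\<close> then give \<open>p = b\<close>, \<open>q = - a\<close>, \<open>s = - c\<close>.  A validation
  point off the decision boundary is classified either correctly (\<open>\<zeta> = z = 0\<close>) or wrongly
  (\<open>\<zeta> = 1\<close>, \<open>z > 0\<close>); in each case two of its four multipliers have inactive constraints, and the
  two equations kill the others (\<open>validation_multipliers_vanish\<close>).

  The core is the training part.  The direction \<open>h\<alpha> = c\<close> gives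
  \<open>c \<bullet> (B B\<^sup>T c) = c \<bullet> (d - r)\<close>.  Every summand on the right is nonpositive, because of the sign
  conditions on the biactive indices and \<open>s = - c\<close> (\<open>training_multiplier_sign\<close>), and \<open>c\<close> lives on
  \<open>\<Lambda>1 \<union> \<Lambda>3\<close> (\<open>training_multiplier_support\<close>).  Positive definiteness on \<open>\<Lambda>1 \<union> \<Lambda>3\<close> therefore forces
  \<open>c = 0\<close>.  Now \<open>r = d\<close>; but \<open>r\<close> lives where \<open>\<alpha> = 0\<close> and \<open>d\<close> where \<open>\<alpha> = C\<close>, and \<open>C > 0\<close> because there
  are support vectors, so both vanish.  The directions \<open>h\<beta>, h\<gamma>\<close> give \<open>k = l = 0\<close>.  Finally the
  multipliers of the two opposite bounds on \<open>C\<close>, and on each component of \<open>wbar\<close>, are equal, and at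
  most one of the two bounds is active.
\<close>


section \<open>Gradients of affine constraint maps\<close>

text \<open>
  The gradient is a definite description, so a gradient has to be exhibited and shown
  unique; the derivative of the whole map supplies it through its adjoint.
\<close>

lemma gradient_component:
  fixes F :: "'v::euclidean_space \<Rightarrow> real ^ 'm::finite"
  assumes "(F has_derivative F') (at v)"
  shows "gradient (\<lambda>u. F u $ i) v \<bullet> h = F' h $ i"
proof -
  have lin: "linear F'"
    using assms by (rule has_derivative_linear)
  define D where "D = adjoint F' (axis i 1)"
  have D: "D \<bullet> h = F' h $ i" for h
    using adjoint_works[OF lin, of h "axis i 1"]
    by (simp add: D_def cart_eq_inner_axis inner_commute)
  have "((\<lambda>u. F u $ i) has_derivative (\<lambda>h. F' h $ i)) (at v)"
    using assms by (rule bounded_linear.has_derivative[OF bounded_linear_vec_nth])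
  moreover have "(\<lambda>h. F' h $ i) = (\<lambda>h. h \<bullet> D)"
    by (simp add: D inner_commute[of _ D])
  ultimately have grad: "GDERIV (\<lambda>u. F u $ i) v :> D"
    by (simp add: gderiv_def)
  have "D' = D" if "GDERIV (\<lambda>u. F u $ i) v :> D'" for D'
  proof -
    have "(\<lambda>h. h \<bullet> D') = (\<lambda>h. h \<bullet> D)"
      using that grad unfolding gderiv_def by (rule has_derivative_unique)
    then have "\<forall>h. h \<bullet> D' = h \<bullet> D" by metis
    then show ?thesis by (simp add: vector_eq_ldot)
  qed
  with grad have "gradient (\<lambda>u. F u $ i) v = D"
    unfolding gradient_def by blast
  then show ?thesis by (simp add: D)
qed

lemma has_derivative_affine:
  fixes F L :: "'v::euclidean_space \<Rightarrow> 'w::euclidean_space"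
  assumes "linear L" and "\<And>u. F u = L u + c"
  shows "(F has_derivative L) (at v)"
proof -
  have "((\<lambda>u. L u + c) has_derivative L) (at v)"
    using assms(1) by (intro has_derivative_add_const bounded_linear_imp_has_derivative)
      (simp add: linear_conv_bounded_linear)
  moreover have "F = (\<lambda>u. L u + c)" using assms(2) by auto
  ultimately show ?thesis by simp
qed


section \<open>Multipliers of a complementarity program\<close>

definition complementary :: "real \<Rightarrow> real \<Rightarrow> bool" where
  "complementary G H \<longleftrightarrow> 0 \<le> G \<and> 0 \<le> H \<and> (G = 0 \<or> H = 0)"

text \<open>
  The conditions on the multipliers \<open>\<mu>\<close> and \<open>\<nu>\<close> of one complementarity pair, after extension by
  zero to the constraints outside the index sets: zero on inactive constraints, nonnegative on
  biactive pairs, and free otherwise.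
\<close>

definition admissible_pair :: "real \<Rightarrow> real \<Rightarrow> real \<Rightarrow> real \<Rightarrow> bool" where
  "admissible_pair G H \<mu> \<nu> \<longleftrightarrow>
     (G \<noteq> 0 \<longrightarrow> \<mu> = 0) \<and> (H \<noteq> 0 \<longrightarrow> \<nu> = 0) \<and> (G = 0 \<and> H = 0 \<longrightarrow> 0 \<le> \<mu> \<and> 0 \<le> \<nu>)"

lemma feasible_complementary:
  assumes "feasible P v"
  shows "complementary (G_map P v $ i) (H_map P v $ i)"
proof -
  have nonneg: "0 \<le> G_map P v $ j" "0 \<le> H_map P v $ j" for j
    using assms by (auto simp: feasible_def less_eq_vec_def)
  have "(\<Sum>j\<in>UNIV. H_map P v $ j * G_map P v $ j) = 0"
    using assms by (simp add: feasible_def inner_vec_def)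
  then have "H_map P v $ i * G_map P v $ i = 0"
    using nonneg by (subst (asm) sum_nonneg_eq_0_iff) auto
  then show ?thesis using nonneg by (auto simp: complementary_def)
qed

text \<open>
  Extending the multipliers by zero turns sums over four index sets into inner products of
  full vectors, and testing a vanishing vector against all directions replaces gradients
  by derivatives.  This is the dual form in which the condition is verified.
\<close>

lemma mpec_mfcqI:
  fixes P :: "('v::euclidean_space, 'i::finite, 'j::finite) mpec"
  assumes g': "(g_map P has_derivative g') (at v)"
    and G': "(G_map P has_derivative G') (at v)"
    and H': "(H_map P has_derivative H') (at v)"
    and vanish: "\<And>\<tau> \<mu> \<nu>.
      \<lbrakk>\<And>i. 0 \<le> \<tau> $ i \<and> (g_map P v $ i \<noteq> 0 \<longrightarrow> \<tau> $ i = 0);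
       \<And>i. admissible_pair (G_map P v $ i) (H_map P v $ i) (\<mu> $ i) (\<nu> $ i);
       \<And>h. \<tau> \<bullet> g' h + \<mu> \<bullet> G' h + \<nu> \<bullet> H' h = 0\<rbrakk>
      \<Longrightarrow> \<tau> = 0 \<and> \<mu> = 0 \<and> \<nu> = 0"
  shows "mpec_mfcq P v"
  unfolding mpec_mfcq_def
proof
  let ?Ia = "I_g P v <+> (I_GH P v <+> I_GH P v)" and ?Ib = "I_G P v <+> I_H P v"
  let ?a = "case_sum (grad_g P v) (case_sum (grad_G P v) (grad_H P v))"
  let ?b = "case_sum (grad_G P v) (grad_H P v)"
  assume "pos_lin_dependent ?Ia ?a ?Ib ?b"
  then show False
    unfolding pos_lin_dependent_def
  proof (elim exE conjE)
    fix t s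
    assume t: "\<forall>i\<in>?Ia. 0 \<le> t i"
      and nonzero: "(\<exists>i\<in>?Ia. t i \<noteq> 0) \<or> (\<exists>i\<in>?Ib. s i \<noteq> 0)"
      and comb: "(\<Sum>i\<in>?Ia. t i *\<^sub>R ?a i) + (\<Sum>i\<in>?Ib. s i *\<^sub>R ?b i) = 0"
    define \<tau> :: "real ^ 'i" where "\<tau> = (\<chi> i. if i \<in> I_g P v then t (Inl i) else 0)"
    \<comment> \<open>The index sets are disjoint, so at most one of the two summands is nonzero.\<close>
    define \<mu> :: "real ^ 'j" where
      "\<mu> = (\<chi> i. (if i \<in> I_GH P v then t (Inr (Inl i)) else 0) + (if i \<in> I_G P v then s (Inl i) else 0))"
    define \<nu> :: "real ^ 'j" where
      "\<nu> = (\<chi> i. (if i \<in> I_GH P v then t (Inr (Inr i)) else 0) + (if i \<in> I_H P v then s (Inr i) else 0))"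
    have "\<tau> = 0 \<and> \<mu> = 0 \<and> \<nu> = 0"
    proof (rule vanish)
      show "0 \<le> \<tau> $ i \<and> (g_map P v $ i \<noteq> 0 \<longrightarrow> \<tau> $ i = 0)" for i
        using t by (auto simp: \<tau>_def I_g_def)
      show "admissible_pair (G_map P v $ i) (H_map P v $ i) (\<mu> $ i) (\<nu> $ i)" for i
        using t by (auto simp: \<mu>_def \<nu>_def admissible_pair_def I_GH_def I_G_def I_H_def)
      show "\<tau> \<bullet> g' h + \<mu> \<bullet> G' h + \<nu> \<bullet> H' h = 0" for h
      proof -
        have if_mult: "(if b then x else 0) * y = (if b then x * y else 0)" for b and x y :: real
          by simp
        have "0 = ((\<Sum>i\<in>?Ia. t i *\<^sub>R ?a i) + (\<Sum>i\<in>?Ib. s i *\<^sub>R ?b i)) \<bullet> h"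
          by (simp add: comb)
        also have "\<dots> = (\<Sum>i\<in>I_g P v. t (Inl i) * g' h $ i) +
            ((\<Sum>i\<in>I_GH P v. t (Inr (Inl i)) * G' h $ i) + (\<Sum>i\<in>I_G P v. s (Inl i) * G' h $ i)) +
            ((\<Sum>i\<in>I_GH P v. t (Inr (Inr i)) * H' h $ i) + (\<Sum>i\<in>I_H P v. s (Inr i) * H' h $ i))"
          by (simp add: sum.Plus o_def inner_add_left inner_sum_left
              gradient_component[OF g'] gradient_component[OF G'] gradient_component[OF H'])
        also have "\<dots> = \<tau> \<bullet> g' h + \<mu> \<bullet> G' h + \<nu> \<bullet> H' h"
          by (simp add: \<tau>_def \<mu>_def \<nu>_def inner_vec_def distrib_right sum.distrib if_mult
              sum.If_cases)
        finally show ?thesis by simp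
      qed
    qed
    then have zero: "\<tau> $ i = 0" "\<mu> $ j = 0" "\<nu> $ j = 0" for i j by simp_all
    have "I_GH P v \<inter> I_G P v = {}" "I_GH P v \<inter> I_H P v = {}"
      by (auto simp: I_GH_def I_G_def I_H_def)
    then have "t (Inl i) = 0" if "i \<in> I_g P v" for i
      using that zero(1)[of i] by (simp add: \<tau>_def)
    moreover have "t (Inr (Inl j)) = 0 \<and> t (Inr (Inr j)) = 0" if "j \<in> I_GH P v" for j
      using that zero(2,3)[of j] by (simp add: \<mu>_def \<nu>_def I_GH_def I_G_def I_H_def)
    moreover have "s (Inl j) = 0" if "j \<in> I_G P v" for j
      using that zero(2)[of j] by (simp add: \<mu>_def I_GH_def I_G_def)
    moreover have "s (Inr j) = 0" if "j \<in> I_H P v" for j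
      using that zero(3)[of j] by (simp add: \<nu>_def I_GH_def I_H_def)
    ultimately show False using nonzero by auto
  qed
qed


section \<open>The multipliers of a single data point\<close>

text \<open>
  Here \<open>u\<close> is the signed score of a validation point.  If \<open>u > 0\<close>, then \<open>\<zeta> = z = 0\<close> and
  both \<open>G\<close>-constraints are inactive, so \<open>a = b = 0\<close>.  If \<open>u < 0\<close>, then \<open>\<zeta> = 1\<close> and \<open>z > 0\<close>, so both
  \<open>H\<close>-constraints are inactive and \<open>p = q = 0\<close>.  For \<open>u = 0\<close> one would get \<open>z = 0\<close>, so \<open>u + z\<close>
  and \<open>z\<close> would both be active and \<open>a = - q\<close> could be nonzero.
\<close>

lemma validation_multipliers_vanish:
  assumes "complementary (u + z) \<zeta>" "complementary (1 - \<zeta>) z"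
    and "admissible_pair (u + z) \<zeta> a p" "admissible_pair (1 - \<zeta>) z b q"
    and "u \<noteq> 0" "p = b" "q = - a"
  shows "a = 0 \<and> b = 0 \<and> p = 0 \<and> q = 0"
proof (cases "0 < u")
  case True
  then have "\<zeta> = 0" "z = 0" "u + z \<noteq> 0"
    using assms(1,2) by (auto simp: complementary_def)
  then show ?thesis using assms by (simp add: admissible_pair_def)
next
  case False
  then have "z > 0" using assms(1,5) by (auto simp: complementary_def)
  then have "\<zeta> = 1" using assms(2) by (auto simp: complementary_def)
  then show ?thesis using assms \<open>z > 0\<close> by (simp add: admissible_pair_def)
qed

text \<open>
  The two complementarity pairs of one training point: \<open>g\<close> is the slack of its margin
  constraint, and the multipliers are \<open>c, r\<close> for the pair \<open>(g, \<alpha>)\<close> and \<open>d, s\<close> for the pair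
  \<open>(C - \<alpha>, \<xi>)\<close>.
\<close>

context
  fixes g \<alpha> \<xi> C c d r s :: real
  assumes compl: "complementary g \<alpha>" "complementary (C - \<alpha>) \<xi>"
    and adm: "admissible_pair g \<alpha> c r" "admissible_pair (C - \<alpha>) \<xi> d s"
    and s: "s = - c" and C: "0 < C"
begin

text \<open>
  These conditions are exactly membership of the point in \<open>\<Lambda>1 \<union> \<Lambda>3\<close>; here \<open>\<xi> = 0\<close>
  because \<open>s = - c\<close> is nonzero as well.
\<close>

lemma training_multiplier_support:
  assumes "c \<noteq> 0"
  shows "g = 0 \<and> \<xi> = 0 \<and> 0 \<le> \<alpha> \<and> \<alpha> \<le> C"
  using assms compl adm s by (auto simp: complementary_def admissible_pair_def)

text \<open>
  For \<open>c \<noteq> 0\<close> both \<open>g\<close> and \<open>\<xi>\<close> vanish.  If \<open>\<alpha> = 0\<close>, the pair \<open>(g, \<alpha>)\<close> is biactive and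
  \<open>C - \<alpha>\<close> inactive, so the product is \<open>- c r\<close> with \<open>c, r \<ge> 0\<close>.  If \<open>\<alpha> = C\<close>, the pair
  \<open>(C - \<alpha>, \<xi>)\<close> is biactive and \<open>\<alpha>\<close> inactive, so the product is \<open>c d = - s d\<close> with
  \<open>d, s \<ge> 0\<close>.  In between, \<open>d = r = 0\<close>.
\<close>

lemma training_multiplier_sign: "c * (d - r) \<le> 0"
proof (cases "c = 0")
  case False
  then have "g = 0" "\<xi> = 0" "0 \<le> \<alpha>"
    using training_multiplier_support by auto
  consider "\<alpha> = 0" | "\<alpha> = C" | "\<alpha> \<noteq> 0" "\<alpha> \<noteq> C" by blast
  then show ?thesis
  proof cases
    case 1
    then have "d = 0" "0 \<le> c" "0 \<le> r"
      using adm C \<open>g = 0\<close> by (auto simp: admissible_pair_def)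
    then show ?thesis by simp
  next
    case 2
    then have "r = 0" "0 \<le> d" "0 \<le> s"
      using adm C \<open>\<xi> = 0\<close> by (auto simp: admissible_pair_def)
    then show ?thesis using s by (simp add: mult_le_0_iff)
  next
    case 3
    then show ?thesis using adm by (simp add: admissible_pair_def)
  qed
qed simp

lemma training_multipliers_disjoint:
  assumes "d = r"
  shows "d = 0"
  using assms adm C by (cases "\<alpha> = C") (auto simp: admissible_pair_def)

end


section \<open>Stacked vectors and block matrices\<close>

lemma stack_nth [simp]: "(u @@ v) $ Inl a = u $ a" "(u @@ v) $ Inr b = v $ b"
  by (simp_all add: stack_def)

text \<open>
  With \<open>split_sum_all\<close>, the quantifier over a nested sum of index types is split until
  every index carries its block, which reduces identities of stacked vectors to their blocks.
\<close>

lemmas vec_eq_iff_summands = vec_eq_iff split_sum_all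

lemma stack_zero: "0 @@ 0 = 0"
  by (simp add: vec_eq_iff_summands)

lemma inner_stack: "(u @@ v) \<bullet> (u' @@ v') = u \<bullet> u' + v \<bullet> v'"
  by (simp add: inner_vec_def sum.Plus o_def flip: UNIV_Plus_UNIV)

lemma stack_cases: obtains u v where "x = u @@ v"
proof
  show "x = (\<chi> a. x $ Inl a) @@ (\<chi> b. x $ Inr b)"
    by (simp add: vec_eq_iff_summands)
qed

lemma block_diag_mult_nth:
  "(block_diag M *v x) $ (t, i) = (M t *v block x t) $ i"
proof -
  have "(block_diag M *v x) $ (t, i) =
      (\<Sum>t'\<in>UNIV. \<Sum>j\<in>UNIV. if t = t' then M t $ i $ j * x $ (t', j) else 0)"
    by (simp add: matrix_vector_mult_def block_diag_def sum.cartesian_product if_distrib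
        case_prod_unfold if_distribR cong: if_cong flip: UNIV_Times_UNIV)
  also have "\<dots> = (\<Sum>j\<in>UNIV. M t $ i $ j * x $ (t, j))"
    by (subst sum.swap) simp
  finally show ?thesis by (simp add: matrix_vector_mult_def block_def)
qed

lemma transpose_block_diag: "transpose (block_diag M) = block_diag (\<lambda>t. transpose (M t))"
  by (simp add: transpose_def block_diag_def vec_eq_iff)

lemma w_fold_eq:
  "w_fold D \<alpha> \<beta> \<gamma> t = block (transpose (B_mat D) *v \<alpha> + \<beta> - \<gamma>) t"
  by (simp add: w_fold_def block_def vec_eq_iff B_mat_def transpose_block_diag
      block_diag_mult_nth[unfolded block_def])

lemma A_mat_mult_nth:
  "(A_mat D *v x) $ (t, i) =
     label D (val_pt D t i) * (feature D (val_pt D t i) \<bullet> block x t)"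
  unfolding A_mat_def block_diag_mult_nth
  by (simp add: val_mat_def matrix_vector_mult_def inner_vec_def sum_distrib_left mult.assoc)

lemma stacked_id_mult_nth: "(stacked_id *v w) $ (t, j) = w $ j"
  by (simp add: matrix_vector_mult_def stacked_id_def if_distribR if_distrib cong: if_cong)

lemma positive_definite_on_submatD:
  fixes M :: "real ^ 'a::finite ^ 'a"
  assumes pd: "positive_definite_on I (submat M I I)"
    and supp: "\<And>i. i \<notin> I \<Longrightarrow> x $ i = 0"
    and "x \<bullet> (M *v x) \<le> 0"
  shows "x = 0"
proof (rule ccontr)
  assume "x \<noteq> 0"
  then have "\<exists>i\<in>I. x $ i \<noteq> 0" using supp by (auto simp: vec_eq_iff)
  then have "0 < (\<Sum>i\<in>I. \<Sum>j\<in>I. x $ i * submat M I I i j * x $ j)"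
    using pd unfolding positive_definite_on_def by blast
  also have "\<dots> = (\<Sum>i\<in>I. \<Sum>j\<in>I. x $ i * (M $ i $ j * x $ j))"
    by (simp add: submat_def mult.assoc)
  also have "\<dots> = (\<Sum>i\<in>UNIV. \<Sum>j\<in>UNIV. x $ i * (M $ i $ j * x $ j))"
    using supp by (intro sum.mono_neutral_cong_left ballI) (auto intro!: sum.neutral)
  also have "\<dots> = x \<bullet> (M *v x)"
    by (simp add: inner_vec_def matrix_vector_mult_def sum_distrib_left)
  finally show False using assms(3) by simp
qed


section \<open>The constraint qualification\<close>

text \<open>
  The map \<open>H\<close> is linear and is its own derivative; the derivatives of \<open>g\<close> and \<open>G\<close> are their
  linear parts.
\<close>

definition g_linear_part ::
  "('k::finite, 'p::finite, 'q::finite, 'n::finite) var \<Rightarrow> real ^ 'n ineq_index" where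
  "g_linear_part = (\<lambda>(C, w, \<zeta>, z, \<alpha>, \<xi>, \<beta>, \<gamma>). vec (- C) @@ vec C @@ (- w) @@ w)"

definition G_linear_part ::
  "('d, 'k::finite, 'p::finite, 'q::finite, 'n::finite) cv_data \<Rightarrow>
   ('k, 'p, 'q, 'n) var \<Rightarrow> real ^ ('k, 'p, 'q, 'n) comp_index" where
  "G_linear_part D = (\<lambda>(C, w, \<zeta>, z, \<alpha>, \<xi>, \<beta>, \<gamma>).
     ((A_mat D ** transpose (B_mat D)) *v \<alpha> + A_mat D *v \<beta> - A_mat D *v \<gamma> + z) @@
     (- \<zeta>) @@
     ((B_mat D ** transpose (B_mat D)) *v \<alpha> + B_mat D *v \<beta> - B_mat D *v \<gamma> + \<xi>) @@
     (vec C - \<alpha>) @@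
     (transpose (B_mat D) *v \<alpha> + \<beta> - \<gamma> + stacked_id *v w) @@
     (- (transpose (B_mat D) *v \<alpha>) - \<beta> + \<gamma> + stacked_id *v w))"

lemma problem_P_derivatives:
  fixes D :: "('d, 'k::finite, 'p::finite, 'q::finite, 'n::finite) cv_data"
  shows "(g_map (problem_P D) has_derivative g_linear_part) (at v)"
    and "(G_map (problem_P D) has_derivative G_linear_part D) (at v)"
    and "(H_map (problem_P D) has_derivative H_map (problem_P D)) (at v)"
proof -
  have "linear (g_linear_part :: ('k, 'p, 'q, 'n) var \<Rightarrow> _)"
    by (rule linearI) (simp_all add: g_linear_part_def vec_eq_iff_summands case_prod_unfold)
  then show "(g_map (problem_P D) has_derivative g_linear_part) (at v)"
    by (rule has_derivative_affine
        [where c = "vec (C_ub D) @@ vec (- C_lb D) @@ wbar_ub D @@ (- wbar_lb D)"])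
      (auto simp: problem_P_def g_linear_part_def vec_eq_iff_summands)
  have "linear (G_linear_part D)"
    by (rule linearI) (auto simp: G_linear_part_def vec_eq_iff_summands matrix_vector_right_distrib
        matrix_vector_mult_scaleR algebra_simps simp del: transpose_matrix_vector)
  then show "(G_map (problem_P D) has_derivative G_linear_part D) (at v)"
    by (rule has_derivative_affine[where c = "0 @@ 1 @@ (- 1) @@ 0 @@ 0 @@ 0"])
      (auto simp: problem_P_def G_linear_part_def vec_eq_iff_summands)
  have "linear (H_map (problem_P D))"
    by (rule linearI) (auto simp: problem_P_def vec_eq_iff_summands)
  then show "(H_map (problem_P D) has_derivative H_map (problem_P D)) (at v)"
    by (rule has_derivative_affine[where c = 0]) simp
qed

theorem theorem1:
  fixes D :: "('d, 'k::finite, 'p::finite, 'q::finite, 'n::finite) cv_data"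
    and C :: real and wbar :: "real ^ 'n"
    and \<zeta> z :: "real ^ ('k \<times> 'p)"
    and \<alpha> \<xi> :: "real ^ ('k \<times> 'q)"
    and \<beta> \<gamma> :: "real ^ ('k \<times> 'n)"
    and v :: "('k, 'p, 'q, 'n) var"
    and \<Lambda>1 \<Lambda>3 :: "('k \<times> 'q) set"
  assumes data: "cv_data_wf D"
    and bounds_C: "C_lb D < C_ub D"
    and bounds_w: "\<forall>j. wbar_lb D $ j < wbar_ub D $ j"
    and v: "v = (C, wbar, \<zeta>, z, \<alpha>, \<xi>, \<beta>, \<gamma>)"
    and feasible: "feasible (problem_P D) v"
    and no_boundary: "\<forall>t i. feature D (val_pt D t i) \<bullet> w_fold D \<alpha> \<beta> \<gamma> t \<noteq> 0"
    and non_support: "\<forall>t. \<forall>y\<in>{-1, 1}. trn_class D t y - support_vectors \<alpha> t \<noteq> {}"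
    and support: "\<forall>t. \<forall>y\<in>{-1, 1}. card (trn_class D t y \<inter> support_vectors \<alpha> t) \<ge> 2"
    and w_bounds: "\<forall>t j. - (wbar $ j) < w_fold D \<alpha> \<beta> \<gamma> t $ j \<and> w_fold D \<alpha> \<beta> \<gamma> t $ j < wbar $ j"
    and \<Lambda>1: "\<Lambda>1 = {i. \<alpha> $ i = 0 \<and>
           ((B_mat D ** transpose (B_mat D)) *v \<alpha> + B_mat D *v \<beta> - B_mat D *v \<gamma> - 1 + \<xi>) $ i = 0 \<and>
           \<xi> $ i = 0}"
    and \<Lambda>3: "\<Lambda>3 = {i. 0 < \<alpha> $ i \<and> \<alpha> $ i \<le> C \<and>
           ((B_mat D ** transpose (B_mat D)) *v \<alpha> + B_mat D *v \<beta> - B_mat D *v \<gamma> - 1 + \<xi>) $ i = 0 \<and>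
           \<xi> $ i = 0}"
    and pos_def: "positive_definite_on (\<Lambda>1 \<union> \<Lambda>3)
           (submat (B_mat D ** transpose (B_mat D)) (\<Lambda>1 \<union> \<Lambda>3) (\<Lambda>1 \<union> \<Lambda>3))"
  shows "mpec_mfcq (problem_P D) v"
proof (rule mpec_mfcqI[OF problem_P_derivatives])
  fix \<tau> :: "real ^ 'n ineq_index" and \<mu> \<nu> :: "real ^ ('k, 'p, 'q, 'n) comp_index"
  let ?A = "A_mat D" and ?B = "B_mat D"
  let ?W = "transpose ?B *v \<alpha> + \<beta> - \<gamma>"
  let ?g3 = "(?B ** transpose ?B) *v \<alpha> + ?B *v \<beta> - ?B *v \<gamma> - 1 + \<xi>"
  assume \<tau>_adm: "\<And>i. 0 \<le> \<tau> $ i \<and> (g_map (problem_P D) v $ i \<noteq> 0 \<longrightarrow> \<tau> $ i = 0)"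
    and adm: "\<And>i. admissible_pair (G_map (problem_P D) v $ i) (H_map (problem_P D) v $ i)
                 (\<mu> $ i) (\<nu> $ i)"
    and stationary: "\<And>h. \<tau> \<bullet> g_linear_part h + \<mu> \<bullet> G_linear_part D h + \<nu> \<bullet> H_map (problem_P D) h = 0"
  note compl = feasible_complementary[OF feasible]
  obtain t1 t2 t3 t4 where \<tau>: "\<tau> = t1 @@ t2 @@ t3 @@ t4"
    by (metis stack_cases)
  obtain a b c d e f where \<mu>: "\<mu> = a @@ b @@ c @@ d @@ e @@ f"
    by (metis stack_cases)
  obtain p q r s k l where \<nu>: "\<nu> = p @@ q @@ r @@ s @@ k @@ l"
    by (metis stack_cases)
  note unfold_P = problem_P_def v \<mu> \<nu>

  have W: "?W $ (t, j) = w_fold D \<alpha> \<beta> \<gamma> t $ j" for t :: 'k and j :: 'n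
    by (simp add: w_fold_eq block_def)

  \<comment> \<open>The strict box constraints make the last two blocks of \<open>G\<close> inactive.\<close>
  have e: "e = 0"
  proof -
    have "e $ (t, j) = 0" for t :: 'k and j :: 'n
    proof -
      have "?W $ (t, j) + wbar $ j \<noteq> 0" using w_bounds[rule_format, of j t] W[of t j] by linarith
      then show ?thesis using adm[of "Inr (Inr (Inr (Inr (Inl (t, j)))))"]
        by (simp add: unfold_P admissible_pair_def stacked_id_mult_nth)
    qed
    then show ?thesis by (simp add: vec_eq_iff)
  qed
  have f: "f = 0"
  proof -
    have "f $ (t, j) = 0" for t :: 'k and j :: 'n
    proof -
      have "- ?W $ (t, j) + wbar $ j \<noteq> 0" using w_bounds[rule_format, of j t] W[of t j] by linarith
      then show ?thesis using adm[of "Inr (Inr (Inr (Inr (Inr (t, j)))))"]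
        by (simp add: unfold_P admissible_pair_def stacked_id_mult_nth)
    qed
    then show ?thesis by (simp add: vec_eq_iff)
  qed

  \<comment> \<open>The vanishing linear form, with one line for each block of the direction.\<close>
  have stat: "(t1 \<bullet> vec (- hC) + t2 \<bullet> vec hC + d \<bullet> vec hC)
      + (t4 - t3) \<bullet> hw
      + (p - b) \<bullet> h\<zeta>
      + (q + a) \<bullet> hz
      + (a \<bullet> ((?A ** transpose ?B) *v h\<alpha>) + c \<bullet> ((?B ** transpose ?B) *v h\<alpha>) + (r - d) \<bullet> h\<alpha>)
      + (s + c) \<bullet> h\<xi>
      + (a \<bullet> (?A *v h\<beta>) + c \<bullet> (?B *v h\<beta>) + k \<bullet> h\<beta>)
      + (l \<bullet> h\<gamma> - a \<bullet> (?A *v h\<gamma>) - c \<bullet> (?B *v h\<gamma>)) = 0"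
    for hC hw h\<zeta> hz h\<alpha> h\<xi> h\<beta> h\<gamma>
    using stationary[of "(hC, hw, h\<zeta>, hz, h\<alpha>, h\<xi>, h\<beta>, h\<gamma>)"]
    by (simp add: problem_P_def g_linear_part_def G_linear_part_def \<tau> \<mu> \<nu> e f inner_stack inner_add_left
        inner_diff_left inner_add_right inner_diff_right)
  have zero_vec: "vec 0 = (0 :: real ^ 'x::finite)" by (simp add: vec_eq_iff)

  have p: "p = b"
  proof -
    have "(p - b) \<bullet> h = 0" for h :: "real ^ ('k \<times> 'p)"
      using stat[of 0 0 h 0 0 0 0 0] by (simp add: zero_vec)
    then show ?thesis using inner_eq_zero_iff[of "p - b"] by simp
  qed
  have q: "q = - a"
  proof -
    have "(q + a) \<bullet> h = 0" for h :: "real ^ ('k \<times> 'p)"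
      using stat[of 0 0 0 h 0 0 0 0] by (simp add: zero_vec)
    then show ?thesis using inner_eq_zero_iff[of "q + a"] by (simp add: eq_neg_iff_add_eq_0)
  qed
  have s: "s = - c"
  proof -
    have "(s + c) \<bullet> h = 0" for h :: "real ^ ('k \<times> 'q)"
      using stat[of 0 0 0 0 0 h 0 0] by (simp add: zero_vec)
    then show ?thesis using inner_eq_zero_iff[of "s + c"] by (simp add: eq_neg_iff_add_eq_0)
  qed

  have validation: "a $ (t, i) = 0 \<and> b $ (t, i) = 0 \<and> p $ (t, i) = 0 \<and> q $ (t, i) = 0" for t i
  proof (rule validation_multipliers_vanish)
    let ?u = "(?A *v ?W) $ (t, i)"
    have G1: "((?A ** transpose ?B) *v \<alpha> + ?A *v \<beta> - ?A *v \<gamma>) $ (t, i) = ?u"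
      by (simp add: matrix_vector_right_distrib matrix_vector_mult_diff_distrib
          matrix_vector_mul_assoc del: transpose_matrix_vector)
    show "complementary (?u + z $ (t, i)) (\<zeta> $ (t, i))"
      using compl[of "Inl (t, i)"] G1 by (simp add: unfold_P)
    show "admissible_pair (?u + z $ (t, i)) (\<zeta> $ (t, i)) (a $ (t, i)) (p $ (t, i))"
      using adm[of "Inl (t, i)"] G1 by (simp add: unfold_P)
    show "complementary (1 - \<zeta> $ (t, i)) (z $ (t, i))"
      using compl[of "Inr (Inl (t, i))"] by (simp add: unfold_P)
    show "admissible_pair (1 - \<zeta> $ (t, i)) (z $ (t, i)) (b $ (t, i)) (q $ (t, i))"
      using adm[of "Inr (Inl (t, i))"] by (simp add: unfold_P)
    have "label D (val_pt D t i) \<noteq> 0"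
      using data by (auto simp: cv_data_wf_def dest: spec[of _ "val_pt D t i"])
    then show "?u \<noteq> 0"
      using no_boundary by (simp add: A_mat_mult_nth w_fold_eq)
  qed (simp_all add: p q)
  then have ab: "a = 0" "b = 0" "p = 0" "q = 0" by (auto simp: vec_eq_iff)

  have "0 < C"
  proof -
    obtain t :: 'k where True by simp
    have "trn_class D t 1 \<inter> support_vectors \<alpha> t \<noteq> {}"
      using support[rule_format, of 1 t] by fastforce
    then obtain i where "0 < \<alpha> $ (t, i)" by (auto simp: support_vectors_def)
    moreover have "\<alpha> $ (t, i) \<le> C"
      using compl[of "Inr (Inr (Inr (Inl (t, i))))"] by (simp add: unfold_P complementary_def)
    ultimately show ?thesis by simp
  qed
  have training: "complementary (?g3 $ i) (\<alpha> $ i)" "complementary (C - \<alpha> $ i) (\<xi> $ i)"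
    "admissible_pair (?g3 $ i) (\<alpha> $ i) (c $ i) (r $ i)"
    "admissible_pair (C - \<alpha> $ i) (\<xi> $ i) (d $ i) (s $ i)"
    "s $ i = - c $ i" "0 < C" for i
    using compl[of "Inr (Inr (Inl i))"] adm[of "Inr (Inr (Inl i))"]
      compl[of "Inr (Inr (Inr (Inl i)))"] adm[of "Inr (Inr (Inr (Inl i)))"] s \<open>0 < C\<close>
    by (simp_all add: unfold_P)

  have c: "c = 0"
  proof (rule positive_definite_on_submatD[OF pos_def])
    show "c $ i = 0" if "i \<notin> \<Lambda>1 \<union> \<Lambda>3" for i
      using training_multiplier_support[OF training, of i] that unfolding \<Lambda>1 \<Lambda>3 by force
    \<comment> \<open>The direction \<open>h\<alpha> = c\<close> makes the quadratic form of \<open>B B\<^sup>T\<close> appear.\<close>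
    have "c \<bullet> ((?B ** transpose ?B) *v c) = c \<bullet> (d - r)"
      using stat[of 0 0 0 0 c 0 0 0]
      by (simp add: zero_vec ab inner_diff_left inner_diff_right inner_commute)
    also have "\<dots> \<le> 0"
      unfolding inner_vec_def using training_multiplier_sign[OF training]
      by (auto intro!: sum_nonpos)
    finally show "c \<bullet> ((?B ** transpose ?B) *v c) \<le> 0" .
  qed

  have "r = d"
  proof -
    have "(r - d) \<bullet> h = 0" for h
      using stat[of 0 0 0 0 h 0 0 0] by (simp add: zero_vec ab c)
    then show ?thesis using inner_eq_zero_iff[of "r - d"] by simp
  qed
  then have d: "d = 0"
    using training_multipliers_disjoint[OF training] by (auto simp: vec_eq_iff)
  \<comment> \<open>The directions \<open>h\<beta> = k\<close> and \<open>h\<gamma> = l\<close> give \<open>k \<bullet> k = 0\<close> and \<open>l \<bullet> l = 0\<close>.\<close>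
  have kl: "k = 0" "l = 0"
    using stat[of 0 0 0 0 0 0 k 0] stat[of 0 0 0 0 0 0 0 l] by (simp_all add: zero_vec ab c)

  have t12: "t1 = 0 \<and> t2 = 0"
  proof -
    have "t1 $ 1 = t2 $ 1"
      using stat[of 1 0 0 0 0 0 0 0] by (simp add: ab c d inner_vec_def)
    moreover have "C_ub D - C = 0 \<or> t1 $ 1 = 0" "C - C_lb D = 0 \<or> t2 $ 1 = 0"
      using \<tau>_adm[of "Inl 1"] \<tau>_adm[of "Inr (Inl 1)"] by (auto simp: problem_P_def v \<tau>)
    ultimately show ?thesis using bounds_C by (auto simp: vec_eq_iff)
  qed
  have t34: "t3 = 0 \<and> t4 = 0"
  proof -
    have "(t4 - t3) \<bullet> h = 0" for h
      using stat[of 0 h 0 0 0 0 0 0] by (simp add: zero_vec)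
    then have "t4 = t3" using inner_eq_zero_iff[of "t4 - t3"] by simp
    moreover have "wbar_ub D $ j - wbar $ j = 0 \<or> t3 $ j = 0"
        "wbar $ j - wbar_lb D $ j = 0 \<or> t4 $ j = 0" for j
      using \<tau>_adm[of "Inr (Inr (Inl j))"] \<tau>_adm[of "Inr (Inr (Inr j))"]
      by (auto simp: problem_P_def v \<tau>)
    ultimately have "t3 $ j = 0" for j
      using bounds_w[rule_format, of j] by (metis eq_iff_diff_eq_0 less_irrefl)
    then show ?thesis using \<open>t4 = t3\<close> by (simp add: vec_eq_iff)
  qed

  show "\<tau> = 0 \<and> \<mu> = 0 \<and> \<nu> = 0"
    using t12 t34 ab c d e f s kl \<open>r = d\<close> by (simp add: \<tau> \<mu> \<nu> stack_zero)
qed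

end
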